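(* The scheme DP does not imply the scheme HE in intuitionistic logic: there is a formula $Px$ such that the instance $\exists y\,(\exists x\,Px\to Py)$ of HE is not derivable in intuitionistic first-order logic extended by all instances of DP.
   Context: Fix a first-order language (without equality) with countably many relation symbols of each arity. Schemata, for arbitrary formulas $Px$ (possibly with further free variables), with $Py$ denoting $Px$ with the fresh variable $y$ substituted for $x$: $\mathrm{DP}(Px) := \exists y\,(Py \to \forall x\, Px)$ (Drinker Paradox) and $\mathrm{HE}(Px) := \exists y\,(\exists x\, Px \to Py)$ (schematic form of Hilbert's Epsilon). Extending a logic by a scheme means adding, for every formula instance of the scheme (possibly with free variables), a premise-free natural deduction rule concluding that instance; $\forall$-introduction may be applied to free variables of such instances. *)

theory Defs
  imports Main
begin

text \<open>
  The language has no function symbols, so terms are variables. Variables are de Bruijn indices.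
  The relation symbols are the pairs \<open>(i, n)\<close> of a name \<open>i\<close> and an arity \<open>n\<close>; the atom
  \<open>Rel i ts\<close> uses the symbol \<open>(i, length ts)\<close>.
\<close>

datatype form =
    Rel nat "nat list"
  | Bot
  | Con form form
  | Dis form form
  | Imp form form
  | All form
  | Exi form

primrec up :: "(nat \<Rightarrow> nat) \<Rightarrow> nat \<Rightarrow> nat" where
  "up f 0 = 0"
| "up f (Suc n) = Suc (f n)"

text \<open>Since terms are variables, capture-avoiding substitution is renaming of free variables.\<close>

primrec ren :: "(nat \<Rightarrow> nat) \<Rightarrow> form \<Rightarrow> form" where
  "ren f (Rel i ts) = Rel i (map f ts)"
| "ren f Bot = Bot"
| "ren f (Con A B) = Con (ren f A) (ren f B)"
| "ren f (Dis A B) = Dis (ren f A) (ren f B)"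
| "ren f (Imp A B) = Imp (ren f A) (ren f B)"
| "ren f (All A) = All (ren (up f) A)"
| "ren f (Exi A) = Exi (ren (up f) A)"

text \<open>
  \<open>lift A\<close> is \<open>A\<close> read under one additional binder: variable 0 is fresh for it.
  \<open>inst t A\<close> substitutes the variable \<open>t\<close> for variable 0 of \<open>A\<close> and removes one binder level.
\<close>

definition lift :: "form \<Rightarrow> form" where
  "lift A = ren Suc A"

definition inst :: "nat \<Rightarrow> form \<Rightarrow> form" where
  "inst t A = ren (case_nat t id) A"

text \<open>
  \<open>nd S \<Gamma> A\<close>: the formula \<open>A\<close> has a natural deduction from open assumptions in \<open>\<Gamma>\<close>, in
  intuitionistic logic extended by a premise-free rule for each formula in \<open>S\<close>. The eigenvariable
  in \<open>AllI\<close> and \<open>ExiE\<close> is variable 0 of the premise; lifting the open assumptions (and the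
  conclusion in \<open>ExiE\<close>) makes it fresh for them. The formulas in \<open>S\<close> are not lifted, so their free
  variables may be generalized.
\<close>

inductive nd :: "form set \<Rightarrow> form set \<Rightarrow> form \<Rightarrow> bool" for S :: "form set" where
  Ax: "A \<in> S \<Longrightarrow> nd S \<Gamma> A"
| Assm: "A \<in> \<Gamma> \<Longrightarrow> nd S \<Gamma> A"
| BotE: "nd S \<Gamma> Bot \<Longrightarrow> nd S \<Gamma> A"
| ConI: "nd S \<Gamma> A \<Longrightarrow> nd S \<Gamma> B \<Longrightarrow> nd S \<Gamma> (Con A B)"
| ConE1: "nd S \<Gamma> (Con A B) \<Longrightarrow> nd S \<Gamma> A"
| ConE2: "nd S \<Gamma> (Con A B) \<Longrightarrow> nd S \<Gamma> B"
| DisI1: "nd S \<Gamma> A \<Longrightarrow> nd S \<Gamma> (Dis A B)"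
| DisI2: "nd S \<Gamma> B \<Longrightarrow> nd S \<Gamma> (Dis A B)"
| DisE: "nd S \<Gamma> (Dis A B) \<Longrightarrow> nd S (insert A \<Gamma>) C \<Longrightarrow> nd S (insert B \<Gamma>) C \<Longrightarrow> nd S \<Gamma> C"
| ImpI: "nd S (insert A \<Gamma>) B \<Longrightarrow> nd S \<Gamma> (Imp A B)"
| ImpE: "nd S \<Gamma> (Imp A B) \<Longrightarrow> nd S \<Gamma> A \<Longrightarrow> nd S \<Gamma> B"
| AllI: "nd S (lift ` \<Gamma>) A \<Longrightarrow> nd S \<Gamma> (All A)"
| AllE: "nd S \<Gamma> (All A) \<Longrightarrow> nd S \<Gamma> (inst t A)"
| ExiI: "nd S \<Gamma> (inst t A) \<Longrightarrow> nd S \<Gamma> (Exi A)"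
| ExiE: "nd S \<Gamma> (Exi A) \<Longrightarrow> nd S (insert A (lift ` \<Gamma>)) (lift C) \<Longrightarrow> nd S \<Gamma> C"

definition derivable :: "form set \<Rightarrow> form \<Rightarrow> bool" where
  "derivable S A \<longleftrightarrow> nd S {} A"

text \<open>
  In the schemata, \<open>x\<close> is variable 0 of \<open>P\<close>. As the body of the outer quantifier, which binds \<open>y\<close>,
  \<open>P\<close> itself is \<open>Py\<close>; the closed-off \<open>\<forall>x. Px\<close> and \<open>\<exists>x. Px\<close> are lifted because they do not contain
  \<open>y\<close>. The other free variables of \<open>P\<close> are parameters of the instance.
\<close>

definition DP :: "form \<Rightarrow> form" where
  "DP P = Exi (Imp P (lift (All P)))"

definition HE :: "form \<Rightarrow> form" where
  "HE P = Exi (Imp (lift (Exi P)) P)"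

end

theory Submission
  imports Defs "HOL-Library.Extended_Nat"
begin

text \<open>
  The separation is semantic: some Kripke model validates every instance of DP and refutes an
  instance of HE. The worlds form a well-order, the future of a world consists of the worlds
  \<^emph>\<open>below\<close> it, and all worlds share one domain of individuals.

  Truth is inherited downwards, so the worlds at which a formula fails are closed upwards, and
  among the sets of worlds \<open>{w. P d fails at w}\<close> there is a largest one, as soon as \<open>\<forall>x. P x\<close> fails
  anywhere: take the least world at which it fails and an individual \<open>d\<close> responsible for the
  failure. This \<open>d\<close> is a drinker at all worlds at once, so DP is valid (\<open>forces_DP\<close>).

  A well-order gives no dual of this: an increasing sequence of truth values need not reach its
  supremum. Over the worlds \<open>0 < 1 < \<dots> < \<infinity>\<close>, let \<open>P d\<close> hold at the finite worlds up to \<open>d\<close>. Then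
  \<open>\<exists>x. P x\<close> holds at all finite worlds and no single \<open>P y\<close> does. The world \<open>\<infinity>\<close>, from which all
  the finite ones are accessible, therefore refutes HE. It has to be there as an additional world:
  each finite world \<open>n\<close> has only the worlds up to \<open>n\<close> in its future and satisfies HE through \<open>y = n\<close>.
\<close>

text \<open>
  Accessible from \<open>w\<close> are the worlds \<open>v \<le> w\<close>. As the domain does not grow along accessibility,
  the clause for \<open>All\<close> can stay at the current world.
\<close>

primrec forces ::
  "('w::order \<Rightarrow> nat \<Rightarrow> 'd list \<Rightarrow> bool) \<Rightarrow> 'w \<Rightarrow> (nat \<Rightarrow> 'd) \<Rightarrow> form \<Rightarrow> bool"
  where
  "forces I w e (Rel i ts) \<longleftrightarrow> I w i (map e ts)"
| "forces I w e Bot \<longleftrightarrow> False"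
| "forces I w e (Con A B) \<longleftrightarrow> forces I w e A \<and> forces I w e B"
| "forces I w e (Dis A B) \<longleftrightarrow> forces I w e A \<or> forces I w e B"
| "forces I w e (Imp A B) \<longleftrightarrow> (\<forall>v\<le>w. forces I v e A \<longrightarrow> forces I v e B)"
| "forces I w e (All A) \<longleftrightarrow> (\<forall>d. forces I w (case_nat d e) A)"
| "forces I w e (Exi A) \<longleftrightarrow> (\<exists>d. forces I w (case_nat d e) A)"

definition persistent :: "('w::order \<Rightarrow> nat \<Rightarrow> 'd list \<Rightarrow> bool) \<Rightarrow> bool" where
  "persistent I \<longleftrightarrow> (\<forall>w v i ds. v \<le> w \<longrightarrow> I w i ds \<longrightarrow> I v i ds)"

lemma forces_mono:
  assumes "persistent I" "v \<le> w" "forces I w e A"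
  shows "forces I v e A"
  using assms(2,3)
proof (induction A arbitrary: e)
  case (Rel i ts)
  with assms(1) show ?case by (auto simp: persistent_def)
next
  case (Imp A B)
  then show ?case by (auto dest: order_trans)
qed auto

lemma case_nat_comp_up: "case_nat d e \<circ> up f = case_nat d (e \<circ> f)"
  by (auto simp: fun_eq_iff split: nat.split)

lemma forces_ren: "forces I w e (ren f A) \<longleftrightarrow> forces I w (e \<circ> f) A"
  by (induction A arbitrary: w e f) (simp_all add: case_nat_comp_up)

lemma forces_lift: "forces I w (case_nat d e) (lift A) \<longleftrightarrow> forces I w e A"
proof -
  have "case_nat d e \<circ> Suc = e" by (simp add: fun_eq_iff)
  then show ?thesis by (simp add: lift_def forces_ren)
qed

lemma forces_inst: "forces I w e (inst t A) \<longleftrightarrow> forces I w (case_nat (e t) e) A"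
proof -
  have "e \<circ> case_nat t id = case_nat (e t) e" by (simp add: fun_eq_iff split: nat.split)
  then show ?thesis by (simp add: inst_def forces_ren)
qed

text \<open>
  The added axioms must be forced under all assignments, not merely under the one considered: the
  eigenvariable rules may generalize their free variables.
\<close>

lemma nd_sound:
  assumes "nd S \<Gamma> A" and I: "persistent I"
    and S: "\<And>B w e. B \<in> S \<Longrightarrow> forces I w e B"
    and "\<And>B. B \<in> \<Gamma> \<Longrightarrow> forces I w e B"
  shows "forces I w e A"
  using assms(1,4)
proof (induction arbitrary: w e rule: nd.induct)
  case (Ax A \<Gamma>)
  then show ?case using S by blast
next
  case (DisE \<Gamma> A B C)
  then have "forces I w e A \<or> forces I w e B" by fastforce
  with DisE show ?case by blast
next
  case (ImpI A \<Gamma> B)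
  show ?case unfolding forces.simps
  proof (intro allI impI)
    fix v assume "v \<le> w" "forces I v e A"
    with ImpI.prems show "forces I v e B"
      by (intro ImpI.IH) (auto intro: forces_mono[OF I])
  qed
next
  case (ImpE \<Gamma> A B)
  then have "\<forall>v\<le>w. forces I v e A \<longrightarrow> forces I v e B" by fastforce
  with ImpE show ?case by blast
next
  case (AllI \<Gamma> A)
  have "forces I w (case_nat d e) A" for d
    using AllI.prems by (intro AllI.IH) (auto simp: forces_lift)
  then show ?case by simp
next
  case (AllE \<Gamma> A t)
  then have "\<forall>d. forces I w (case_nat d e) A" by fastforce
  then show ?case by (simp add: forces_inst)
next
  case (ExiI \<Gamma> t A)
  then show ?case by (auto simp: forces_inst)
next
  case (ExiE \<Gamma> A C)
  then obtain d where "forces I w (case_nat d e) A" by fastforce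
  then have "forces I w (case_nat d e) (lift C)"
    using ExiE.prems by (intro ExiE.IH(2)) (auto simp: forces_lift)
  then show ?case by (simp add: forces_lift)
qed fastforce+

text \<open>
  An individual violating \<open>P\<close> at the least world where \<open>\<forall>x. P x\<close> fails violates it, by monotonicity,
  wherever \<open>\<forall>x. P x\<close> fails.
\<close>

lemma forces_DP:
  fixes w :: "'w::wellorder"
  assumes I: "persistent I"
  shows "forces I w e (DP P)"
proof -
  let ?fails = "\<lambda>v. \<not> forces I v e (All P)"
  have "\<exists>d. \<forall>v. forces I v (case_nat d e) P \<longrightarrow> forces I v e (All P)"
  proof (cases "\<exists>v. ?fails v")
    case True
    then have "?fails (LEAST v. ?fails v)" by (rule LeastI_ex)
    then obtain d where d: "\<not> forces I (LEAST v. ?fails v) (case_nat d e) P" by auto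
    have "\<not> forces I v (case_nat d e) P" if "?fails v" for v
      using forces_mono[OF I Least_le[of ?fails, OF that]] d by blast
    then show ?thesis by blast
  qed blast
  then show ?thesis by (auto simp: DP_def forces_lift simp del: forces.simps(6))
qed

theorem proposition6:
  "\<exists>P. \<not> derivable (range DP) (HE P)"
proof
  let ?P = "Rel 0 [0]"
  let ?I = "\<lambda>(w::enat) (i::nat) ds. w \<le> enat (hd ds)"
  have I: "persistent ?I" by (auto simp: persistent_def dest: order_trans)
  show "\<not> derivable (range DP) (HE ?P)"
  proof
    assume "derivable (range DP) (HE ?P)"
    then have "forces ?I \<infinity> id (HE ?P)"
      unfolding derivable_def by (rule nd_sound[OF _ I]) (auto intro: forces_DP[OF I])
    then obtain y where y: "\<And>v. \<exists>x. v \<le> enat x \<Longrightarrow> v \<le> enat y"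
      by (auto simp: HE_def forces_lift)
    \<comment> \<open>One world above \<open>y\<close>, the predicate still holds of \<open>Suc y\<close>, but no longer of \<open>y\<close>.\<close>
    have "enat (Suc y) \<le> enat y" by (rule y) blast
    then show False by simp
  qed
qed

end
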